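(* Let $d=d(n)$ be a number of parties satisfying $d(n)=\omega(n^{c'})$ for every constant $c'>0$. Then there exist functions $f=f_n:(\{0,1\}^n)^{d}\to\{0,1\}$ such that for every constant $c>0$, $D(f)=\omega\bigl(\log^c rk(M(f))\bigr)$ as $n\to\infty$.
   Context: $D(f)$ is the deterministic communication complexity of $f$ in the number-in-hand multiparty model: each of the $d$ parties receives one of the $d$ inputs in $\{0,1\}^n$, and $D(f)$ is the minimum over deterministic protocols computing $f$ of the worst-case number of bits communicated. The communication tensor $M(f)$ is the $d$-dimensional array indexed by $(\{0,1\}^n)^d$ with entries $f(x_1,\dots,x_d)$, and $rk(M(f))$ is its tensor rank over the reals: the minimum $r$ such that $M(f)=\sum_{i=1}^r v_{1,i}\otimes\cdots\otimes v_{d,i}$ with real vectors $v_{j,i}\in\mathbb{R}^{2^n}$. Logarithms are base 2; $g=\omega(h)$ means $g/h\to\infty$. *)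

theory Defs
  imports Complex_Main "HOL-Library.FuncSet"
begin

definition cube :: "nat \<Rightarrow> bool list set" where
  "cube n = {w. length w = n}"

definition inputs :: "nat \<Rightarrow> nat \<Rightarrow> (nat \<Rightarrow> bool list) set" where
  "inputs d n = (\<Pi>\<^sub>E j \<in> {..<d}. cube n)"

(* Broadcast protocols as trees: at a node "Send j g P Q" party j announces the bit g (x j),
   which depends only on its own input x j and, via the position in the tree, on the bits
   announced so far; the play continues with P if the bit is True and with Q otherwise. *)
datatype 'a protocol =
    Output bool
  | Send nat "'a \<Rightarrow> bool" "'a protocol" "'a protocol"

primrec parties :: "'a protocol \<Rightarrow> nat set" where
  "parties (Output b) = {}"
| "parties (Send j g P Q) = insert j (parties P \<union> parties Q)"

primrec run :: "'a protocol \<Rightarrow> (nat \<Rightarrow> 'a) \<Rightarrow> bool" where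
  "run (Output b) x = b"
| "run (Send j g P Q) x = (if g (x j) then run P x else run Q x)"

primrec bits_sent :: "'a protocol \<Rightarrow> (nat \<Rightarrow> 'a) \<Rightarrow> nat" where
  "bits_sent (Output b) x = 0"
| "bits_sent (Send j g P Q) x = Suc (if g (x j) then bits_sent P x else bits_sent Q x)"

definition computes ::
    "nat \<Rightarrow> nat \<Rightarrow> bool list protocol \<Rightarrow> ((nat \<Rightarrow> bool list) \<Rightarrow> bool) \<Rightarrow> bool" where
  "computes d n P f \<longleftrightarrow> parties P \<subseteq> {..<d} \<and> (\<forall>x \<in> inputs d n. run P x = f x)"

definition worst_case_cost :: "nat \<Rightarrow> nat \<Rightarrow> bool list protocol \<Rightarrow> nat" where
  "worst_case_cost d n P = Max (bits_sent P ` inputs d n)"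

definition det_comm_complexity :: "nat \<Rightarrow> nat \<Rightarrow> ((nat \<Rightarrow> bool list) \<Rightarrow> bool) \<Rightarrow> nat" where
  "det_comm_complexity d n f = (LEAST k. \<exists>P. computes d n P f \<and> worst_case_cost d n P = k)"

definition comm_tensor :: "((nat \<Rightarrow> bool list) \<Rightarrow> bool) \<Rightarrow> (nat \<Rightarrow> bool list) \<Rightarrow> real" where
  "comm_tensor f x = of_bool (f x)"

(* Rank of the d-dimensional array T with all index sets equal to X. The vector in position j of
   the i-th rank-one summand is v j i; only its values on X matter. *)
definition tensor_rank :: "nat \<Rightarrow> 'a set \<Rightarrow> ((nat \<Rightarrow> 'a) \<Rightarrow> real) \<Rightarrow> nat" where
  "tensor_rank d X T = (LEAST r. \<exists>v :: nat \<Rightarrow> nat \<Rightarrow> 'a \<Rightarrow> real.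
     \<forall>x \<in> (\<Pi>\<^sub>E j \<in> {..<d}. X). T x = (\<Sum>i<r. \<Prod>j<d. v j i (x j)))"

(* The quotient form is used instead of Landau_Symbols' smallomega because the latter also holds
   when both functions are identically 0, which would admit constant Boolean functions
   (complexity 0, logarithm of the rank 0). With x / 0 = 0, the quotient form requires h to be
   nonzero eventually. *)
definition little_omega :: "(nat \<Rightarrow> real) \<Rightarrow> (nat \<Rightarrow> real) \<Rightarrow> bool" where
  "little_omega g h \<longleftrightarrow> filterlim (\<lambda>n. g n / h n) at_top sequentially"

end

theory Submission
  imports Defs
begin

text \<open>
  Already the function that asks whether the first bits of all parties agree separates the two
  quantities. Its tensor is the sum of the indicators of "all first bits are 1" and "all first bits
  are 0", so it has rank 2 and the logarithm of its rank is 1. On the other hand, at the all-ones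
  input the value changes as soon as any single party changes its input, so all \<open>d\<close> parties must
  speak there, and \<open>d\<close> tends to infinity.
\<close>

lemma finite_inputs: "finite (inputs d n)"
proof -
  have "finite (cube n)"
    unfolding cube_def using finite_lists_length_eq[of "UNIV :: bool set" n] by simp
  then show ?thesis
    unfolding inputs_def by (intro finite_PiE) auto
qed

text \<open>The parties that speak on input \<open>x\<close> form the certificate \<open>A\<close>.\<close>

lemma certificate_le_bits_sent:
  "\<exists>A. finite A \<and> card A \<le> bits_sent P x \<and> (\<forall>y. (\<forall>j\<in>A. y j = x j) \<longrightarrow> run P y = run P x)"
proof (induction P)
  case (Output b)
  show ?case by (intro exI[of _ "{}"]) simp
next
  case (Send j g P Q)
  define R where "R = (if g (x j) then P else Q)"
  have "\<exists>A. finite A \<and> card A \<le> bits_sent R x \<and> (\<forall>y. (\<forall>j\<in>A. y j = x j) \<longrightarrow> run R y = run R x)"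
    unfolding R_def using Send.IH by simp
  then obtain A where "finite A" "card A \<le> bits_sent R x"
    and "\<And>y. \<forall>j\<in>A. y j = x j \<Longrightarrow> run R y = run R x"
    by blast
  note A = this
  \<comment> \<open>Agreement at \<open>j\<close> makes \<open>y\<close> take the same branch
    \<open>R\<close> as \<open>x\<close>; agreement on \<open>A\<close> then fixes the value
    there.\<close>
  have "run (Send j g P Q) y = run (Send j g P Q) x" if "\<forall>i\<in>insert j A. y i = x i" for y
    using A(3)[of y] that by (simp add: R_def split: if_splits)
  moreover have "card (insert j A) \<le> bits_sent (Send j g P Q) x"
    using A(1,2) card_insert_le_m1[of "Suc (bits_sent R x)" A j]
    by (simp add: R_def split: if_splits)
  ultimately show ?case
    using A(1) by blast
qed

text \<open>A certificate contains every sensitive party: changing \<open>x\<close> at a party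
  outside it keeps the value of \<open>run\<close>.\<close>

lemma card_sensitive_le_bits_sent:
  assumes "\<And>j. j \<in> S \<Longrightarrow> \<exists>w. run P (x(j := w)) \<noteq> run P x"
  shows "card S \<le> bits_sent P x"
proof -
  obtain A where A: "finite A" "card A \<le> bits_sent P x"
    and cert: "\<And>y. \<forall>j\<in>A. y j = x j \<Longrightarrow> run P y = run P x"
    using certificate_le_bits_sent[of P x] by blast
  have "S \<subseteq> A"
  proof (rule subsetI, rule ccontr)
    fix j assume "j \<in> S" "j \<notin> A"
    obtain w where "run P (x(j := w)) \<noteq> run P x"
      using assms \<open>j \<in> S\<close> by blast
    then show False
      using cert[of "x(j := w)"] \<open>j \<notin> A\<close> by auto
  qed
  then show ?thesis
    using A card_mono le_trans by blast
qed

lemma card_sensitive_le_det_comm_complexity: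
  assumes "computes d n P f" and x: "x \<in> inputs d n"
    and sens: "\<And>j. j \<in> S \<Longrightarrow> \<exists>w. x(j := w) \<in> inputs d n \<and> f (x(j := w)) \<noteq> f x"
  shows "card S \<le> det_comm_complexity d n f"
proof -
  \<comment> \<open>The given protocol makes the set under \<open>LEAST\<close> nonempty, so an
    optimal protocol \<open>Q\<close> attains the minimum.\<close>
  have "\<exists>Q. computes d n Q f \<and> worst_case_cost d n Q = det_comm_complexity d n f"
    unfolding det_comm_complexity_def
    by (rule LeastI_ex[where P = "\<lambda>k. \<exists>Q. computes d n Q f \<and> worst_case_cost d n Q = k"])
      (use assms(1) in blast)
  then obtain Q where Q: "computes d n Q f"
    and cost: "worst_case_cost d n Q = det_comm_complexity d n f"
    by blast
  have run: "run Q y = f y" if "y \<in> inputs d n" for y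
    using Q that by (simp add: computes_def)
  have "card S \<le> bits_sent Q x"
  proof (rule card_sensitive_le_bits_sent)
    fix j assume "j \<in> S"
    then obtain w where "x(j := w) \<in> inputs d n" "f (x(j := w)) \<noteq> f x"
      using sens by blast
    then show "\<exists>w. run Q (x(j := w)) \<noteq> run Q x"
      using run x by (intro exI[of _ w]) simp
  qed
  also have "\<dots> \<le> worst_case_cost d n Q"
    unfolding worst_case_cost_def using finite_inputs x by (intro Max_ge) auto
  finally show ?thesis
    by (simp add: cost)
qed

text \<open>\<open>hd\<close> reads the first bit; \<open>hd []\<close> is unspecified, hence the
  assumption \<open>0 < n\<close> in the bounds below.\<close>

definition agree :: "nat \<Rightarrow> (nat \<Rightarrow> bool list) \<Rightarrow> bool" where
  "agree d x \<longleftrightarrow> (\<forall>j<d. hd (x j)) \<or> (\<forall>j<d. \<not> hd (x j))"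

primrec all_heads :: "bool \<Rightarrow> nat \<Rightarrow> bool list protocol" where
  "all_heads b 0 = Output True"
| "all_heads b (Suc k) = Send k (\<lambda>w. hd w = b) (all_heads b k) (Output False)"

lemma run_all_heads: "run (all_heads b k) x \<longleftrightarrow> (\<forall>j<k. hd (x j) = b)"
  by (induction k) (auto simp: less_Suc_eq)

lemma parties_all_heads: "parties (all_heads b k) = {..<k}"
  by (induction k) (auto simp: lessThan_Suc)

text \<open>Party 0 announces the bit that all others must match, so it has to exist. The cost is
  irrelevant: the protocol serves to show that the complexity is an attained minimum.\<close>

lemma computes_agree:
  assumes "0 < d"
  shows "computes d n (Send 0 hd (all_heads True d) (all_heads False d)) (agree d)"
proof -
  have "run (Send 0 hd (all_heads True d) (all_heads False d)) x = agree d x" for x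
    unfolding agree_def using assms by (cases "hd (x 0)") (simp_all add: run_all_heads, blast+)
  then show ?thesis
    using assms by (simp add: computes_def parties_all_heads)
qed

lemma const_input:
  "length w = n \<Longrightarrow> restrict (\<lambda>_. w) {..<d} \<in> inputs d n"
  by (simp add: inputs_def cube_def)

lemma le_det_comm_complexity_agree:
  assumes "0 < n" "2 \<le> d"
  shows "d \<le> det_comm_complexity d n (agree d)"
proof -
  define x where "x = restrict (\<lambda>_. replicate n True) {..<d}"
  have x: "x \<in> inputs d n"
    unfolding x_def by (intro const_input) simp
  have "x(j := replicate n False) \<in> inputs d n \<and> agree d (x(j := replicate n False)) \<noteq> agree d x"
    if "j < d" for j
  proof -
    have "x(j := replicate n False) \<in> inputs d n"
      using x that by (auto simp: inputs_def cube_def PiE_iff extensional_def)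
    \<comment> \<open>A second party \<open>i\<close> keeps the bit 1, so flipping \<open>j\<close>
      destroys agreement; with one party \<open>agree\<close> would be constantly true.\<close>
    moreover obtain i where "i < d" "i \<noteq> j"
      using assms(2) by (metis One_nat_def Suc_1 Suc_le_lessD less_trans nat_neq_iff zero_less_one)
    ultimately show ?thesis
      using that \<open>0 < n\<close> by (auto simp: agree_def x_def hd_replicate)
  qed
  then show ?thesis
    using card_sensitive_le_det_comm_complexity[OF computes_agree x, of "{..<d}"] assms(2)
    by (metis card_lessThan lessThan_iff less_le_trans pos2)
qed

text \<open>This exhibits a conjunction of conditions on separate coordinates as a rank-one
  tensor.\<close>

lemma prod_of_bool_lessThan:
  "(\<Prod>j<(d::nat). of_bool (P j)) = (of_bool (\<forall>j<d. P j) :: 'a :: comm_semiring_1)"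
  by (induction d) (auto simp: less_Suc_eq)

lemma tensor_rank_agree:
  assumes "0 < n" "2 \<le> d"
  shows "tensor_rank d (cube n) (comm_tensor (agree d)) = 2"
  unfolding tensor_rank_def inputs_def[symmetric]
proof (rule Least_equality)
  \<comment> \<open>The summand \<open>i = 0\<close> marks all heads 1, \<open>i = 1\<close> all
    heads 0. Party 0 witnesses that they are never both 1.\<close>
  have "comm_tensor (agree d) x = (\<Sum>i<2. \<Prod>j<d. of_bool (hd (x j) = (i = (0::nat))))" for x
    using assms(2)
    by (simp add: comm_tensor_def agree_def numeral_2_eq_2 prod_of_bool_lessThan)
      (auto intro: exI[of _ 0])
  then show "\<exists>v :: nat \<Rightarrow> nat \<Rightarrow> bool list \<Rightarrow> real.
    \<forall>x\<in>inputs d n. comm_tensor (agree d) x = (\<Sum>i<2. \<Prod>j<d. v j i (x j))"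
    by (intro exI[of _ "\<lambda>j i w. of_bool (hd w = (i = 0))"]) blast
next
  fix r :: nat
  assume "\<exists>v :: nat \<Rightarrow> nat \<Rightarrow> bool list \<Rightarrow> real.
    \<forall>x\<in>inputs d n. comm_tensor (agree d) x = (\<Sum>i<r. \<Prod>j<d. v j i (x j))"
  then obtain v :: "nat \<Rightarrow> nat \<Rightarrow> bool list \<Rightarrow> real"
    where v: "\<And>x. x \<in> inputs d n \<Longrightarrow> comm_tensor (agree d) x = (\<Sum>i<r. \<Prod>j<d. v j i (x j))"
    by blast
  define x where "x b = restrict (\<lambda>_. replicate n b) {..<d}" for b :: bool
  have x: "x b \<in> inputs d n" for b
    unfolding x_def by (intro const_input) simp
  have one: "comm_tensor (agree d) (x b) = 1" for b
    using \<open>0 < n\<close> by (cases b) (auto simp: comm_tensor_def agree_def x_def hd_replicate)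
  have "r \<noteq> 0"
    using v[OF x[of True]] one[of True] by (cases r) auto
  moreover have "r \<noteq> 1"
  proof
    assume "r = 1"
    \<comment> \<open>The single product equals 1 at both constant inputs, so no factor vanishes on
      either constant string.\<close>
    have nonzero: "v j 0 (replicate n b) \<noteq> 0" if "j < d" for j b
    proof
      assume "v j 0 (replicate n b) = 0"
      then have "(\<Prod>j<d. v j 0 (replicate n b)) = 0"
        using that by (intro prod_zero) auto
      moreover have "(\<Prod>j<d. v j 0 (replicate n b)) = 1"
        using v[OF x[of b]] one[of b] \<open>r = 1\<close> by (simp add: x_def)
      ultimately show False
        by (metis zero_neq_one)
    qed
    \<comment> \<open>A mixed input has only nonzero factors, yet \<open>agree\<close> fails on
      it.\<close>
    define y where "y = (x True)(0 := replicate n False)"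
    have "y \<in> inputs d n"
      using x[of True] assms(2) by (auto simp: y_def inputs_def cube_def PiE_iff extensional_def)
    then have "comm_tensor (agree d) y = (\<Prod>j<d. v j 0 (y j))"
      using v \<open>r = 1\<close> by simp
    also have "\<dots> \<noteq> 0"
      using nonzero by (auto simp: y_def x_def prod_zero_iff)
    finally have "agree d y"
      by (simp add: comm_tensor_def)
    moreover have "\<not> hd (y 0)" "hd (y 1)"
      using assms by (auto simp: y_def x_def hd_replicate)
    moreover have "0 < d" "1 < d"
      using assms(2) by auto
    ultimately show False
      unfolding agree_def by blast
  qed
  ultimately show "2 \<le> r"
    by linarith
qed

theorem theorem3:
  fixes d :: "nat \<Rightarrow> nat"
  assumes "\<And>c' :: real. c' > 0 \<Longrightarrow> little_omega (\<lambda>n. real (d n)) (\<lambda>n. real n powr c')"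
  shows "\<exists>f :: nat \<Rightarrow> (nat \<Rightarrow> bool list) \<Rightarrow> bool. \<forall>c :: real. c > 0 \<longrightarrow>
    little_omega (\<lambda>n. real (det_comm_complexity (d n) n (f n)))
      (\<lambda>n. log 2 (real (tensor_rank (d n) (cube n) (comm_tensor (f n)))) powr c)"
proof (intro exI[of _ "\<lambda>n. agree (d n)"] allI impI)
  fix c :: real
  \<comment> \<open>The exponent 1 suffices: it gives \<open>n \<le> d n\<close> eventually, and
    with \<open>2 \<le> n\<close> also the \<open>2 \<le> d n\<close> that both bounds
    require.\<close>
  have "filterlim (\<lambda>n. real (d n) / real n powr 1) at_top sequentially"
    using assms[of 1] by (simp add: little_omega_def)
  then have "\<forall>\<^sub>F n in sequentially. 1 \<le> real (d n) / real n powr 1"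
    by (simp add: filterlim_at_top)
  moreover have "\<forall>\<^sub>F n in sequentially. 2 \<le> n"
    by (rule eventually_ge_at_top)
  ultimately have "\<forall>\<^sub>F n in sequentially. real n \<le> real (det_comm_complexity (d n) n (agree (d n))) /
      log 2 (real (tensor_rank (d n) (cube n) (comm_tensor (agree (d n))))) powr c"
  proof eventually_elim
    case (elim n)
    then have "n \<le> d n"
      by (simp add: divide_simps)
    \<comment> \<open>The denominator is \<open>log 2 2 powr c = 1\<close>, so the quotient is the
      complexity, which is at least \<open>d n\<close>.\<close>
    then show ?case
      using elim le_det_comm_complexity_agree[of n "d n"] by (simp add: tensor_rank_agree)
  qed
  then show "little_omega (\<lambda>n. real (det_comm_complexity (d n) n (agree (d n))))
      (\<lambda>n. log 2 (real (tensor_rank (d n) (cube n) (comm_tensor (agree (d n))))) powr c)"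
    unfolding little_omega_def by (rule filterlim_at_top_mono[OF filterlim_real_sequentially])
qed

end
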